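(* Let $0\le x_0<x_F<\infty$ and $\theta>0$, and suppose $X_1,\dots,X_n$ are i.i.d. from $F_\theta$, where $F_\theta(x)=1-\left(\frac{x_F-x}{x_F-x_0}\right)^\theta$ for $x\in[x_0,x_F]$. Let $\tau^*$ be the optimal full-information stopping rule. Then, as $n\to\infty$, $$\mathrm{CR}_n(\tau^*;\theta)=1-\Theta\!\left(n^{-1/\theta}\right).$$
   Context: Stopping problem: $X_1,\dots,X_n$ are observed sequentially and $X_{n+1}:=0$. A policy is a stopping time $\tau\in\{1,\dots,n\}\cup\{n+1\}$ adapted to $(X_t)$, with reward $X_\tau$. $\mathrm{OPT}(\theta):=\mathbb E_\theta[\max_{t\in[n]}X_t]$ and $\mathrm{CR}_n(\tau;\theta):=\mathbb E_\theta[X_\tau]/\mathrm{OPT}(\theta)$. The optimal full-information stopping rule $\tau^*$ is the stopping time maximizing $\mathbb E_\theta[X_\tau]$ when $\theta$ is known. $A_n=1-\Theta(b_n)$ means that $1-A_n$ lies between two positive constant multiples of $b_n$ for all large $n$ (constants may depend on $\theta,x_0,x_F$). *)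

theory Defs
  imports "HOL-Probability.Probability"
begin

definition F_cdf :: "real \<Rightarrow> real \<Rightarrow> real \<Rightarrow> real \<Rightarrow> real" where
  "F_cdf x0 xF \<theta> x =
     (if x < x0 then 0
      else if x \<le> xF then 1 - ((xF - x) / (xF - x0)) powr \<theta>
      else 1)"

text \<open>Only the observations with indices 1, ..., n are used; \<open>X 0\<close> is irrelevant.\<close>

definition iid_sample :: "'a measure \<Rightarrow> nat \<Rightarrow> (nat \<Rightarrow> 'a \<Rightarrow> real) \<Rightarrow> (real \<Rightarrow> real) \<Rightarrow> bool" where
  "iid_sample M n X F \<longleftrightarrow>
     prob_space M \<and>
     prob_space.indep_vars M (\<lambda>_. borel) X {1..n} \<and>
     (\<forall>i\<in>{1..n}. cdf (distr M borel (X i)) = F)"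

text \<open>The observations extended by the convention that the value at index n + 1, which stands
  for never stopping, is 0.\<close>

definition extend :: "nat \<Rightarrow> (nat \<Rightarrow> 'a \<Rightarrow> real) \<Rightarrow> nat \<Rightarrow> 'a \<Rightarrow> real" where
  "extend n X t \<omega> = (if t \<le> n then X t \<omega> else 0)"

definition natural_filtration :: "'a measure \<Rightarrow> (nat \<Rightarrow> 'a \<Rightarrow> real) \<Rightarrow> nat \<Rightarrow> 'a measure" where
  "natural_filtration M Y t =
     sigma (space M) (\<Union>s\<in>{1..t}. {Y s -` B \<inter> space M | B. B \<in> sets borel})"

definition policy :: "'a measure \<Rightarrow> nat \<Rightarrow> (nat \<Rightarrow> 'a \<Rightarrow> real) \<Rightarrow> ('a \<Rightarrow> nat) \<Rightarrow> bool" where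
  "policy M n X \<tau> \<longleftrightarrow>
     stopping_time (natural_filtration M (extend n X)) \<tau> \<and>
     (\<forall>\<omega>\<in>space M. \<tau> \<omega> \<in> {1..n + 1})"

definition expected_reward :: "'a measure \<Rightarrow> nat \<Rightarrow> (nat \<Rightarrow> 'a \<Rightarrow> real) \<Rightarrow> ('a \<Rightarrow> nat) \<Rightarrow> real" where
  "expected_reward M n X \<tau> = (LINT \<omega>|M. extend n X (\<tau> \<omega>) \<omega>)"

definition OPT :: "'a measure \<Rightarrow> nat \<Rightarrow> (nat \<Rightarrow> 'a \<Rightarrow> real) \<Rightarrow> real" where
  "OPT M n X = (LINT \<omega>|M. Max ((\<lambda>t. X t \<omega>) ` {1..n}))"

definition CR :: "'a measure \<Rightarrow> nat \<Rightarrow> (nat \<Rightarrow> 'a \<Rightarrow> real) \<Rightarrow> ('a \<Rightarrow> nat) \<Rightarrow> real" where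
  "CR M n X \<tau> = expected_reward M n X \<tau> / OPT M n X"

text \<open>Policies are arbitrary functions of the sample space, so they may depend on the
  distribution of the observations: this is optimality under full information.\<close>

definition optimal_policy :: "'a measure \<Rightarrow> nat \<Rightarrow> (nat \<Rightarrow> 'a \<Rightarrow> real) \<Rightarrow> ('a \<Rightarrow> nat) \<Rightarrow> bool" where
  "optimal_policy M n X \<tau> \<longleftrightarrow>
     policy M n X \<tau> \<and>
     (\<forall>\<sigma>. policy M n X \<sigma> \<longrightarrow> expected_reward M n X \<sigma> \<le> expected_reward M n X \<tau>)"

end

theory Submission
  imports Defs
begin

text \<open>Write \<open>Y = xF - X\<close> for the cost of an observation, so that \<open>Y\<close> is below \<open>y\<close> with
  probability \<open>(y / (xF - x0)) powr \<theta>\<close> and the least of \<open>n\<close> costs has order \<open>n powr (-1/\<theta>)\<close>.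

  Lower bound for the loss: consider costs of order \<open>n powr (-1/\<theta>)\<close>. With positive probability the
  best cost of the first half of the sample is of this order. The decision to stop within the first
  half is independent of the second half, which with positive probability contains a distinctly
  better cost, and with positive probability contains only distinctly worse ones; either way the
  policy loses a constant multiple of \<open>n powr (-1/\<theta>)\<close>.

  Upper bound for the loss: a single threshold would cost a logarithmic factor, so let the
  threshold be a fixed fraction of the cost bound \<open>v\<close> for the remaining observations. The bound then
  obeys \<open>v' = v * (1 - \<kappa> * v powr \<theta>)\<close>, so \<open>v powr (-\<theta>)\<close> grows at least linearly.\<close>

text \<open>The argument for the lower bound uses the cost levels
  \<open>(xF - x0) * (K / n) powr (1/\<theta>)\<close> for \<open>K = 1/14, 1/7, 1/2, 1\<close>, below which a cost falls with
  probability \<open>K / n\<close>.\<close>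

definition level_gap :: "real \<Rightarrow> real" where
  "level_gap \<theta> = min ((1/7) powr (1/\<theta>) - (1/14) powr (1/\<theta>)) (1 - (1/2) powr (1/\<theta>))"

lemma level_gap_pos: "0 < \<theta> \<Longrightarrow> 0 < level_gap \<theta>"
  using powr_less_mono2[of "1/\<theta>" "1/14" "1/7"] powr_less_mono2[of "1/\<theta>" "1/2" 1]
  by (simp add: level_gap_def)

section \<open>The sample and its joint distribution\<close>

locale power_sample = prob_space M
  for M :: "'a measure" +
  fixes n :: nat and X :: "nat \<Rightarrow> 'a \<Rightarrow> real" and x0 xF \<theta> :: real
  assumes iid: "iid_sample M n X (F_cdf x0 xF \<theta>)"
    and n_pos: "0 < n" and x0_nonneg: "0 \<le> x0" and x0_less: "x0 < xF" and theta_pos: "0 < \<theta>"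
begin

text \<open>In terms of costs, every index in \<open>I\<close> has cost at least \<open>y i\<close>.
  The level may vary with the index because time-dependent thresholds need this; the two-block
  argument uses constant levels.\<close>

definition below :: "nat set \<Rightarrow> (nat \<Rightarrow> real) \<Rightarrow> 'a set" where
  "below I y = {\<omega> \<in> space M. \<forall>i\<in>I. X i \<omega> \<le> xF - y i}"

lemma indep: "indep_vars (\<lambda>_. borel) X {1..n}"
  using iid by (simp add: iid_sample_def)

lemma random_variable [measurable]: "i \<in> {1..n} \<Longrightarrow> random_variable borel (X i)"
  using indep unfolding indep_vars_def by blast

lemma random_variable_extend [measurable]: "1 \<le> t \<Longrightarrow> random_variable borel (extend n X t)"
  by (cases "t \<le> n") (auto simp: extend_def[abs_def] intro: random_variable)

lemma prob_le:
  assumes "i \<in> {1..n}"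
  shows "prob {\<omega> \<in> space M. X i \<omega> \<le> x} = F_cdf x0 xF \<theta> x"
proof -
  have "F_cdf x0 xF \<theta> x = cdf (distr M borel (X i)) x"
    using iid assms by (simp add: iid_sample_def)
  also have "\<dots> = prob (X i -` {..x} \<inter> space M)"
    unfolding cdf_def by (rule measure_distr) (use random_variable[OF assms] in auto)
  also have "X i -` {..x} \<inter> space M = {\<omega> \<in> space M. X i \<omega> \<le> x}" by auto
  finally show ?thesis by simp
qed

lemma F_cdf_diff:
  assumes "0 \<le> y" "y \<le> xF - x0"
  shows "F_cdf x0 xF \<theta> (xF - y) = 1 - (y / (xF - x0)) powr \<theta>"
  using assms by (auto simp: F_cdf_def)

lemma AE_sample_bounds: "AE \<omega> in M. \<forall>i\<in>{1..n}. 0 \<le> X i \<omega> \<and> X i \<omega> \<le> xF"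
proof (rule AE_finite_allI)
  fix i assume i: "i \<in> {1..n}"
  note [measurable] = random_variable[OF i]
  have "AE \<omega> in M. X i \<omega> \<le> xF"
    using prob_le[OF i, of xF] F_cdf_diff[of 0] x0_less
    by (subst prob_Collect_eq_1[symmetric]) auto
  moreover have "AE \<omega> in M. \<not> X i \<omega> \<le> x0"
    using prob_le[OF i, of x0] F_cdf_diff[of "xF - x0"] x0_less
    by (subst prob_Collect_eq_0[symmetric]) auto
  ultimately show "AE \<omega> in M. 0 \<le> X i \<omega> \<and> X i \<omega> \<le> xF"
    by eventually_elim (use x0_nonneg in auto)
qed simp

lemma below_events:
  assumes I: "I \<subseteq> {1..n}"
  shows "below I y \<in> events"
proof -
  have "finite I" using I by (rule finite_subset) simp
  moreover have "{\<omega> \<in> space M. X i \<omega> \<le> xF - y i} \<in> events" if "i \<in> I" for i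
    using random_variable[of i] that I by (intro borel_measurable_le) auto
  ultimately show ?thesis
    unfolding below_def by (intro sets.sets_Collect_finite_All) auto
qed

lemma prob_below:
  assumes I: "I \<subseteq> {1..n}" and y: "\<And>i. i \<in> I \<Longrightarrow> 0 \<le> y i \<and> y i \<le> xF - x0"
  shows "prob (below I y) = (\<Prod>i\<in>I. 1 - (y i / (xF - x0)) powr \<theta>)"
proof (cases "I = {}")
  case True
  then show ?thesis by (simp add: below_def prob_space)
next
  case False
  have fin: "finite I" using I by (rule finite_subset) simp
  have "below I y = (\<Inter>i\<in>I. X i -` {..xF - y i} \<inter> space M)"
    using False by (auto simp: below_def)
  also have "prob \<dots> = (\<Prod>i\<in>I. prob (X i -` {..xF - y i} \<inter> space M))"
    by (rule indep_varsD_finite[OF indep_vars_subset[OF indep I] False fin]) auto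
  also have "\<dots> = (\<Prod>i\<in>I. 1 - (y i / (xF - x0)) powr \<theta>)"
  proof (rule prod.cong)
    fix i assume i: "i \<in> I"
    have "X i -` {..xF - y i} \<inter> space M = {\<omega> \<in> space M. X i \<omega> \<le> xF - y i}" by auto
    then show "prob (X i -` {..xF - y i} \<inter> space M) = 1 - (y i / (xF - x0)) powr \<theta>"
      using prob_le[of i "xF - y i"] F_cdf_diff[of "y i"] y[OF i] I i by auto
  qed simp
  finally show ?thesis .
qed

subsection \<open>Policies and observed information\<close>

lemma space_natural_filtration [simp]: "space (natural_filtration M Y t) = space M"
  by (simp add: natural_filtration_def space_measure_of_conv)

lemma sets_natural_filtration:
  "sets (natural_filtration M Y t) =
     sigma_sets (space M) (\<Union>s\<in>{1..t}. {Y s -` B \<inter> space M | B. B \<in> sets borel})"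
  unfolding natural_filtration_def by (rule sets_measure_of) auto

text \<open>The natural filtration only covers initial segments of the indices; the independence
  argument also needs the information of a later block such as \<open>{m<..n}\<close>.\<close>

definition observed :: "nat set \<Rightarrow> 'a measure" where
  "observed I = sigma (space M) (\<Union>s\<in>I. {X s -` B \<inter> space M | B. B \<in> sets borel})"

lemma space_observed [simp]: "space (observed I) = space M"
  by (simp add: observed_def space_measure_of_conv)

lemma sets_observed:
  "sets (observed I) = sigma_sets (space M) (\<Union>s\<in>I. {X s -` B \<inter> space M | B. B \<in> sets borel})"
  unfolding observed_def by (rule sets_measure_of) auto

lemma sets_natural_filtration_extend:
  assumes "m \<le> n"
  shows "sets (natural_filtration M (extend n X) m) = sets (observed {1..m})"
proof -
  have "extend n X s = X s" if "s \<in> {1..m}" for s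
    using that assms by (auto simp: extend_def)
  then show ?thesis unfolding sets_natural_filtration sets_observed by simp
qed

lemma below_observed:
  assumes "finite I" "I \<subseteq> J"
  shows "below I y \<in> sets (observed J)"
proof -
  have "{\<omega> \<in> space (observed J). X i \<omega> \<le> xF - y i} \<in> sets (observed J)" if "i \<in> I" for i
  proof -
    have "{\<omega> \<in> space (observed J). X i \<omega> \<le> xF - y i} = X i -` {..xF - y i} \<inter> space M" by auto
    also have "\<dots> \<in> sets (observed J)"
      unfolding sets_observed using that assms by (intro sigma_sets.Basic) (auto intro!: exI[of _ "{..xF - y i}"])
    finally show ?thesis .
  qed
  then have "{\<omega> \<in> space (observed J). \<forall>i\<in>I. X i \<omega> \<le> xF - y i} \<in> sets (observed J)"
    using assms by (intro sets.sets_Collect_finite_All) auto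
  then show ?thesis by (simp add: below_def)
qed

text \<open>Independence of single observations passes to sigma-algebras generated by disjoint
  blocks, because the preimages generating each of them are closed under intersection. The two
  blocks are indexed by the booleans.\<close>

lemma prob_observed_Int:
  assumes IJ: "I \<inter> J = {}" "I \<union> J \<subseteq> {1..n}"
    and A: "A \<in> sets (observed I)" and B: "B \<in> sets (observed J)"
  shows "prob (A \<inter> B) = prob A * prob B"
proof -
  let ?E = "\<lambda>i. {X i -` B \<inter> space M | B. B \<in> sets borel}"
  have "indep_sets (\<lambda>b. sigma_sets (space M) (\<Union>i\<in>(case b of True \<Rightarrow> I | False \<Rightarrow> J). ?E i)) UNIV"
  proof (rule indep_sets_collect_sigma)
    have "indep_sets ?E {1..n}" using indep by (simp add: indep_vars_def2)
    then show "indep_sets ?E (\<Union>b\<in>UNIV. case b of True \<Rightarrow> I | False \<Rightarrow> J)"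
      by (rule indep_sets_mono_index[rotated]) (use IJ(2) in \<open>fastforce split: bool.splits\<close>)
    show "Int_stable (?E i)" for i
      unfolding Int_stable_def by clarsimp (metis Int_assoc Int_left_commute inf.idem sets.Int vimage_Int)
    show "disjoint_family_on (\<lambda>b. case b of True \<Rightarrow> I | False \<Rightarrow> J) UNIV"
      using IJ by (auto simp: disjoint_family_on_def split: bool.splits)
  qed
  from indep_setsD[OF this, of UNIV "case_bool A B"] show ?thesis
    using A B by (simp add: sets_observed UNIV_bool ac_simps)
qed

section \<open>Measurability, integrability and range of rewards\<close>

lemma natural_filtration_events: "sets (natural_filtration M (extend n X) t) \<subseteq> events"
  unfolding sets_natural_filtration
  by (rule sets.sigma_sets_subset) (auto intro: measurable_sets random_variable_extend)

lemma policy_measurable: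
  assumes "policy M n X \<tau>"
  shows "\<tau> \<in> measurable M (count_space UNIV)"
proof -
  have "\<tau> \<in> borel_measurable M"
    using assms unfolding policy_def
    by (intro measurable_stopping_time[where F = "natural_filtration M (extend n X)"])
       (use natural_filtration_events in auto)
  then show ?thesis
    by (simp add: measurable_cong_sets[OF refl sets_borel_eq_count_space])
qed

text \<open>The index of the observation is itself random, so the reward is split into a finite sum
  over the possible values of \<open>\<tau>\<close>.\<close>

lemma reward_measurable:
  assumes \<tau>: "policy M n X \<tau>"
  shows "(\<lambda>\<omega>. extend n X (\<tau> \<omega>) \<omega>) \<in> borel_measurable M"
proof -
  note [measurable] = policy_measurable[OF \<tau>]
  have "(\<lambda>\<omega>. \<Sum>t\<in>{1..n+1}. if \<tau> \<omega> = t then extend n X t \<omega> else 0) \<in> borel_measurable M"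
    by (intro borel_measurable_sum measurable_If) (auto intro: random_variable_extend)
  moreover have "(\<Sum>t\<in>{1..n+1}. if \<tau> \<omega> = t then extend n X t \<omega> else 0) = extend n X (\<tau> \<omega>) \<omega>"
    if "\<omega> \<in> space M" for \<omega>
    using \<tau> that by (subst sum.delta') (auto simp: policy_def)
  ultimately show ?thesis by (simp cong: measurable_cong)
qed

lemma max_measurable: "(\<lambda>\<omega>. Max ((\<lambda>t. X t \<omega>) ` {1..n})) \<in> borel_measurable M"
  by (rule borel_measurable_Max) (auto intro: random_variable)

text \<open>The value 0 for never stopping also lies below the maximum, since almost surely no
  observation is negative.\<close>

lemma AE_reward_bounds:
  assumes \<tau>: "policy M n X \<tau>"
  shows "AE \<omega> in M. 0 \<le> extend n X (\<tau> \<omega>) \<omega> \<and>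
    extend n X (\<tau> \<omega>) \<omega> \<le> Max ((\<lambda>t. X t \<omega>) ` {1..n}) \<and> Max ((\<lambda>t. X t \<omega>) ` {1..n}) \<le> xF"
  using AE_sample_bounds AE_space
proof eventually_elim
  case (elim \<omega>)
  let ?m = "Max ((\<lambda>t. X t \<omega>) ` {1..n})"
  have ge: "X t \<omega> \<le> ?m" if "t \<in> {1..n}" for t
    using that by (intro Max_ge) auto
  have "?m \<le> xF" using elim n_pos by (subst Max_le_iff) auto
  moreover have one: "1 \<in> {1..n}" using n_pos by auto
  then have "0 \<le> ?m" using order_trans[of 0 "X 1 \<omega>" ?m] ge[OF one] elim(1) by blast
  moreover have "\<tau> \<omega> \<in> {1..n+1}" using \<tau> elim by (auto simp: policy_def)
  ultimately show ?case using ge[of "\<tau> \<omega>"] elim by (auto simp: extend_def)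
qed

lemma reward_integrable:
  assumes \<tau>: "policy M n X \<tau>"
  shows "integrable M (\<lambda>\<omega>. extend n X (\<tau> \<omega>) \<omega>)"
proof (rule integrable_const_bound[OF _ reward_measurable[OF \<tau>]])
  show "AE \<omega> in M. norm (extend n X (\<tau> \<omega>) \<omega>) \<le> xF"
    using AE_reward_bounds[OF \<tau>] by eventually_elim auto
qed

lemma max_integrable:
  assumes \<tau>: "policy M n X \<tau>"
  shows "integrable M (\<lambda>\<omega>. Max ((\<lambda>t. X t \<omega>) ` {1..n}))"
proof (rule integrable_const_bound[OF _ max_measurable])
  show "AE \<omega> in M. norm (Max ((\<lambda>t. X t \<omega>) ` {1..n})) \<le> xF"
    using AE_reward_bounds[OF \<tau>] by eventually_elim auto
qed

lemma reward_le_OPT: "policy M n X \<tau> \<Longrightarrow> expected_reward M n X \<tau> \<le> OPT M n X"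
  unfolding expected_reward_def OPT_def
  by (rule integral_mono_AE) (use AE_reward_bounds reward_integrable max_integrable in auto)

lemma OPT_le:
  assumes "policy M n X \<tau>"
  shows "OPT M n X \<le> xF"
proof -
  have "OPT M n X \<le> (LINT \<omega>|M. xF)"
    unfolding OPT_def using assms
    by (intro integral_mono_AE) (use AE_reward_bounds max_integrable in auto)
  then show ?thesis by (simp add: prob_space)
qed

subsection \<open>Loss of an arbitrary policy\<close>

text \<open>Let \<open>G\<close> be the event that the least cost \<open>xF - X i\<close> of the first block of observations lies in
  \<open>[y1, y2)\<close>. On \<open>G\<close>, stopping within the first block is wrong if the second block has a cost below
  \<open>y0\<close>, and continuing is wrong if all costs of the second block are at least \<open>y3\<close>; the policy has
  to choose before it sees the second block.\<close>

lemma regret_ge: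
  assumes \<tau>: "policy M n X \<tau>" and m: "m \<le> n"
    and y: "y1 \<le> y2" "y3 \<le> xF - x0"
    and d: "0 \<le> d" "d \<le> y1 - y0" "d \<le> y3 - y2"
    and r: "r \<le> 1 - prob (below {m<..n} (\<lambda>_. y0))" "r \<le> prob (below {m<..n} (\<lambda>_. y3))"
  shows "d * (r * (prob (below {1..m} (\<lambda>_. y1)) - prob (below {1..m} (\<lambda>_. y2))))
    \<le> OPT M n X - expected_reward M n X \<tau>"
proof -
  define G where "G = below {1..m} (\<lambda>_. y1) - below {1..m} (\<lambda>_. y2)"
  define B where "B = {\<omega> \<in> space M. \<tau> \<omega> \<le> m}"
  define L0 where "L0 = space M - below {m<..n} (\<lambda>_. y0)"
  define L3 where "L3 = below {m<..n} (\<lambda>_. y3)"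
  have mn: "{1..m} \<subseteq> {1..n}" "{m<..n} \<subseteq> {1..n}" using m by auto
  \<comment> \<open>The stopping-time property enters here: whether \<open>\<tau>\<close> stops
    within the first block is decided by that block alone, hence independently of \<open>L0\<close>
    and \<open>L3\<close>.\<close>
  have "Measurable.pred (natural_filtration M (extend n X) m) (\<lambda>\<omega>. \<tau> \<omega> \<le> m)"
    using \<tau> by (auto simp: policy_def stopping_time_def)
  then have B_obs: "B \<in> sets (observed {1..m})"
    using m by (simp add: B_def pred_def sets_natural_filtration_extend)
  have G_obs: "G \<in> sets (observed {1..m})"
    unfolding G_def by (intro sets.Diff below_observed) auto
  have L3_obs: "L3 \<in> sets (observed {m<..n})"
    unfolding L3_def by (intro below_observed) auto
  have L0_obs: "L0 \<in> sets (observed {m<..n})"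
    unfolding L0_def using sets.compl_sets[OF below_observed[of "{m<..n}" "{m<..n}"]] by simp
  have obs_ev: "sets (observed I) \<subseteq> events" if "I \<subseteq> {1..n}" for I
    unfolding sets_observed using that
    by (intro sets.sigma_sets_subset) (auto intro: measurable_sets random_variable)
  note ev = obs_ev[OF mn(1), THEN subsetD] obs_ev[OF mn(2), THEN subsetD]
  have G_ev: "G \<in> events" and B_ev: "B \<in> events" and L0_ev: "L0 \<in> events" and L3_ev: "L3 \<in> events"
    using ev G_obs B_obs L0_obs L3_obs by auto
  have prod: "prob (A \<inter> L) = prob A * prob L"
    if "A \<in> sets (observed {1..m})" "L \<in> sets (observed {m<..n})" for A L
    by (rule prob_observed_Int[OF _ _ that]) (use m in auto)
  have "prob G = prob (below {1..m} (\<lambda>_. y1)) - prob (below {1..m} (\<lambda>_. y2))"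
    unfolding G_def using y(1) mn by (intro finite_measure_Diff below_events) (auto simp: below_def)
  also have "prob G = prob (G \<inter> B) + prob (G - B)"
    using G_ev B_ev by (metis Int_Diff_disjoint Int_Diff_Un finite_measure_Union sets.Diff sets.Int)
  finally have q: "prob (below {1..m} (\<lambda>_. y1)) - prob (below {1..m} (\<lambda>_. y2)) = prob (G \<inter> B) + prob (G - B)"
    by simp
  \<comment> \<open>The event of a wrong decision: stopping early although a distinctly better value
    follows, or continuing although only distinctly worse ones follow. Since \<open>r\<close> bounds
    the probability of either continuation from below, the choice made on \<open>G\<close> does not
    matter.\<close>
  define W where "W = (G \<inter> B \<inter> L0) \<union> ((G - B) \<inter> L3)"
  have W_ev: "W \<in> events" using G_ev B_ev L0_ev L3_ev by (auto simp: W_def)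
  have "r * (prob (G \<inter> B) + prob (G - B)) \<le> prob (G \<inter> B) * prob L0 + prob (G - B) * prob L3"
  proof -
    have "prob L0 = 1 - prob (below {m<..n} (\<lambda>_. y0))"
      unfolding L0_def by (rule prob_compl) (use mn in \<open>auto intro: below_events\<close>)
    then have "prob (G \<inter> B) * r \<le> prob (G \<inter> B) * prob L0"
      using r by (intro mult_left_mono) auto
    moreover have "prob (G - B) * r \<le> prob (G - B) * prob L3"
      using r by (intro mult_left_mono) (auto simp: L3_def)
    ultimately show ?thesis by (simp add: algebra_simps)
  qed
  also have "\<dots> = prob (G \<inter> B \<inter> L0) + prob ((G - B) \<inter> L3)"
    using prod[of "G \<inter> B" L0] prod[of "G - B" L3] G_obs B_obs L0_obs L3_obs by auto
  also have "\<dots> = prob W"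
    unfolding W_def using G_ev B_ev L0_ev L3_ev by (intro finite_measure_Union[symmetric]) auto
  finally have "d * (r * (prob (G \<inter> B) + prob (G - B))) \<le> d * prob W"
    using d by (intro mult_left_mono) auto
  also have "\<dots> = (LINT \<omega>|M. d * indicator W \<omega>)" using W_ev by simp
  also have "\<dots> \<le> (LINT \<omega>|M. Max ((\<lambda>t. X t \<omega>) ` {1..n}) - extend n X (\<tau> \<omega>) \<omega>)"
  proof (rule integral_mono_AE)
    show "integrable M (\<lambda>\<omega>. d * indicator W \<omega>)"
      using W_ev by (intro integrable_mult_right integrable_real_indicator) (auto simp: less_top[symmetric])
    show "integrable M (\<lambda>\<omega>. Max ((\<lambda>t. X t \<omega>) ` {1..n}) - extend n X (\<tau> \<omega>) \<omega>)"
      using max_integrable[OF \<tau>] reward_integrable[OF \<tau>] by simp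
    show "AE \<omega> in M. d * indicator W \<omega> \<le> Max ((\<lambda>t. X t \<omega>) ` {1..n}) - extend n X (\<tau> \<omega>) \<omega>"
      using AE_reward_bounds[OF \<tau>] AE_space
    proof eventually_elim
      case (elim \<omega>)
      let ?m = "Max ((\<lambda>t. X t \<omega>) ` {1..n})"
      have ge: "X t \<omega> \<le> ?m" if "t \<in> {1..n}" for t
        using that by (intro Max_ge) auto
      have \<tau>\<omega>: "\<tau> \<omega> \<in> {1..n+1}" using \<tau> elim by (auto simp: policy_def)
      consider "\<omega> \<notin> W" | "\<omega> \<in> G" "\<tau> \<omega> \<le> m" "\<omega> \<in> L0" | "\<omega> \<in> G" "m < \<tau> \<omega>" "\<omega> \<in> L3"
        using elim unfolding W_def B_def by fastforce
      then show ?case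
      proof cases
        case 1
        then show ?thesis using elim by simp
      next
        case 2
        then have "extend n X (\<tau> \<omega>) \<omega> \<le> xF - y1"
          using \<tau>\<omega> m by (auto simp: extend_def G_def below_def)
        moreover obtain t where "t \<in> {m<..n}" "xF - y0 < X t \<omega>"
          using 2 elim by (auto simp: L0_def below_def not_le)
        moreover have "X t \<omega> \<le> ?m"
          by (rule ge) (use \<open>t \<in> {m<..n}\<close> in auto)
        ultimately have "y1 - y0 \<le> ?m - extend n X (\<tau> \<omega>) \<omega>" by linarith
        then show ?thesis using d elim by (auto simp: indicator_def)
      next
        case 3
        \<comment> \<open>This includes never stopping: its reward 0 is at most \<open>x0\<close>,
          hence at most \<open>xF - y3\<close>.\<close>
        then have "extend n X (\<tau> \<omega>) \<omega> \<le> xF - y3"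
          using \<tau>\<omega> y x0_nonneg by (auto simp: extend_def L3_def below_def)
        moreover obtain t where "t \<in> {1..m}" "xF - y2 < X t \<omega>"
          using 3 elim by (auto simp: G_def below_def not_le)
        moreover have "X t \<omega> \<le> ?m"
          by (rule ge) (use \<open>t \<in> {1..m}\<close> m in auto)
        ultimately have "y3 - y2 \<le> ?m - extend n X (\<tau> \<omega>) \<omega>" by linarith
        then show ?thesis using d elim by (auto simp: indicator_def)
      qed
    qed
  qed
  also have "\<dots> = OPT M n X - expected_reward M n X \<tau>"
    unfolding OPT_def expected_reward_def
    using max_integrable[OF \<tau>] reward_integrable[OF \<tau>] by simp
  finally show ?thesis unfolding q .
qed

text \<open>Apply \<open>regret_ge\<close> to the two halves of the sample, with
  \<open>K = 1/14, 1/7, 1/2, 1\<close> giving \<open>y0\<close> to \<open>y3\<close>. The least cost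
  of the first half lies in the middle range with probability at least \<open>13/14 - 12/14\<close>,
  and \<open>r = 1/29\<close> is admissible, whence \<open>406 = 14 * 29\<close>.\<close>

lemma regret_ge_powr:
  assumes n2: "2 \<le> n" and \<tau>: "policy M n X \<tau>"
  shows "(xF - x0) * level_gap \<theta> / 406 * real n powr (-1/\<theta>) \<le> OPT M n X - expected_reward M n X \<tau>"
proof -
  define d where "d = level_gap \<theta>"
  have d_pos: "0 < d" using level_gap_pos[OF theta_pos] by (simp add: d_def)
  define D where "D = xF - x0"
  define s where "s = D * real n powr (-1/\<theta>)"
  define y where "y K = s * K powr (1/\<theta>)" for K
  define m where "m = n div 2"
  have D_pos: "0 < D" using x0_less by (simp add: D_def)
  then have s_pos: "0 < s" using n_pos by (simp add: s_def)
  have y_alt: "y K = D * (K / real n) powr (1/\<theta>)" if "0 \<le> K" for K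
    using that n_pos by (simp add: y_def s_def powr_divide powr_minus_divide)
  have y_powr: "(y K / D) powr \<theta> = K / real n" if "0 \<le> K" for K
    using that n_pos D_pos theta_pos by (simp add: y_alt powr_powr)
  have y_bounds: "0 \<le> y K \<and> y K \<le> D" if "0 \<le> K" "K \<le> 1" for K
  proof -
    have "K / real n \<le> 1" using that n_pos by simp
    then have "(K / real n) powr (1/\<theta>) \<le> 1 powr (1/\<theta>)"
      using that theta_pos by (intro powr_mono2) auto
    then show ?thesis using that D_pos by (simp add: y_alt mult_left_le)
  qed
  have prob_y: "prob (below I (\<lambda>_. y K)) = (1 - K / n) ^ card I"
    if "0 \<le> K" "K \<le> 1" "I \<subseteq> {1..n}" for K I
    using that by (subst prob_below) (auto simp: y_bounds[unfolded D_def] y_powr[unfolded D_def])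
  have pow_lower: "1 - k * (K / n) \<le> (1 - K / n) ^ k" if "0 \<le> K" "K \<le> 1" for k and K :: real
    using Bernoulli_inequality[of "- (K / n)" k] that n2 by (simp add: divide_le_eq)
  \<comment> \<open>Passing through \<open>exp\<close> to a rational bound leaves only rational
    arithmetic for the numerical estimates below.\<close>
  have pow_upper: "(1 - K / n) ^ k \<le> 1 / (1 + k * (K / n))" if "0 \<le> K" "K \<le> 1" for k and K :: real
  proof -
    have "(1 - K / n) ^ k \<le> exp (- (K / n)) ^ k"
      using exp_ge_add_one_self[of "- (K / n)"] that n2 by (intro power_mono) auto
    also have "\<dots> = 1 / exp (k * (K / n))" by (simp add: exp_of_nat_mult[symmetric] exp_minus divide_simps)
    also have "\<dots> \<le> 1 / (1 + k * (K / n))"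
      using exp_ge_add_one_self[of "k * (K / n)"] that
      by (intro divide_left_mono mult_pos_pos add_pos_nonneg) auto
    finally show ?thesis .
  qed
  \<comment> \<open>The assumption \<open>2 \<le> n\<close> is needed for
    \<open>n \<le> 3 * m\<close>, which is an equality at \<open>n = 3\<close>.\<close>
  have m: "n \<le> 3 * m" "2 * m \<le> n" "m \<le> n" "n \<le> 2 * (n - m)" using n2 by (auto simp: m_def)
  have q1: "prob (below {1..m} (\<lambda>_. y (1/7))) \<ge> 13 / 14"
  proof -
    have "real m * (1 / 7 / n) \<le> 1 / 14" using m n_pos by (simp add: divide_simps)
    then show ?thesis using pow_lower[of "1/7" m] m by (subst prob_y) auto
  qed
  have q2: "prob (below {1..m} (\<lambda>_. y (1/2))) \<le> 12 / 14"
  proof -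
    have "1 / 6 \<le> real m * (1 / 2 / n)" using of_nat_mono[OF m(1), where 'a = real] n_pos by (simp add: field_simps)
    then have "1 / (1 + real m * (1 / 2 / n)) \<le> 1 / (1 + 1 / 6)" by (intro divide_left_mono) auto
    then show ?thesis using pow_upper[of "1/2" m] m by (subst prob_y) auto
  qed
  have r0: "1 / 29 \<le> 1 - prob (below {m<..n} (\<lambda>_. y (1/14)))"
  proof -
    have "real n \<le> 2 * real (n - m)" using of_nat_mono[OF m(4), where 'a = real] by simp
    then have "1 / 28 \<le> real (n - m) * (1 / 14 / n)"
      using n_pos by (simp add: divide_simps del: of_nat_diff)
    then have "1 / (1 + real (n - m) * (1 / 14 / n)) \<le> 1 / (1 + 1 / 28)"
      by (intro frac_le add_left_mono) (auto simp del: of_nat_diff)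
    then show ?thesis using pow_upper[of "1/14" "n - m"] m by (subst prob_y) auto
  qed
  have r3: "1 / 29 \<le> prob (below {m<..n} (\<lambda>_. y 1))"
  proof -
    have "1 / 29 \<le> 1 - real (n - m) * (1 / n)"
      using m n_pos by (simp add: of_nat_diff divide_simps)
    also have "\<dots> \<le> (1 - 1 / n) ^ (n - m)" using pow_lower[of 1 "n - m"] by simp
    finally show ?thesis using m by (subst prob_y) auto
  qed
  have "s * d * (1/29 * (1/14))
    \<le> s * d * (1/29 * (prob (below {1..m} (\<lambda>_. y (1/7))) - prob (below {1..m} (\<lambda>_. y (1/2)))))"
    using q1 q2 s_pos d_pos by (intro mult_left_mono) auto
  also have "\<dots> \<le> OPT M n X - expected_reward M n X \<tau>"
  proof (rule regret_ge[OF \<tau> m(3) _ _ _ _ _ r0 r3])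
    show "y (1/7) \<le> y (1/2)"
      unfolding y_def using s_pos theta_pos by (intro mult_left_mono powr_mono2) auto
    show "y 1 \<le> xF - x0" using y_bounds[of 1] by (simp add: D_def)
    show "0 \<le> s * d" using s_pos d_pos by simp
    have "s * d \<le> s * ((1/7) powr (1/\<theta>) - (1/14) powr (1/\<theta>))" "s * d \<le> s * (1 - (1/2) powr (1/\<theta>))"
      using s_pos by (auto simp: d_def level_gap_def intro!: mult_left_mono)
    then show "s * d \<le> y (1/7) - y (1/14)" "s * d \<le> y 1 - y (1/2)"
      by (simp_all add: y_def right_diff_distrib)
  qed
  finally show ?thesis
    by (simp add: s_def D_def d_def mult_ac)
qed

subsection \<open>Threshold policies\<close>

text \<open>Backward induction for costs: stopping at \<open>t\<close> costs at most
  \<open>h t\<close>, continuing at most \<open>u (t + 1)\<close> on average, so \<open>u\<close>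
  bounds the expected remaining cost. The terminal value \<open>xF\<close> is the cost of never
  stopping, whose reward is 0.\<close>

lemma threshold_policy:
  assumes h: "\<And>t. t \<in> {1..n} \<Longrightarrow> 0 \<le> h t \<and> h t \<le> xF - x0"
    and u: "u (n + 1) = xF"
    and step: "\<And>t. t \<in> {1..n} \<Longrightarrow>
      (h t / (xF - x0)) powr \<theta> * h t + (1 - (h t / (xF - x0)) powr \<theta>) * u (t + 1) \<le> u t"
  obtains \<sigma> where "policy M n X \<sigma>" "xF - u 1 \<le> expected_reward M n X \<sigma>"
proof -
  \<comment> \<open>Stop at the first cost below its threshold; the alternative \<open>n + 1\<close>
    makes the least element exist.\<close>
  define \<sigma> where "\<sigma> \<omega> = (LEAST t. t = n + 1 \<or> t \<in> {1..n} \<and> xF - h t < X t \<omega>)" for \<omega>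
  define S where "S t = below {1..<t} h" for t
  define p where "p t = (h t / (xF - x0)) powr \<theta>" for t
  define Q where "Q t = prob (S t)" for t
  have \<sigma>_alt: "\<sigma> \<omega> = n + 1 \<or> \<sigma> \<omega> \<in> {1..n} \<and> xF - h (\<sigma> \<omega>) < X (\<sigma> \<omega>) \<omega>" for \<omega>
    unfolding \<sigma>_def by (rule LeastI[of _ "n + 1"]) simp
  have \<sigma>_range: "\<sigma> \<omega> \<in> {1..n + 1}" for \<omega> using \<sigma>_alt[of \<omega>] by auto
  have S_iff: "\<omega> \<in> S t \<longleftrightarrow> t \<le> \<sigma> \<omega>" if "\<omega> \<in> space M" "t \<in> {1..n + 1}" for \<omega> t
  proof
    assume "\<omega> \<in> S t"
    then show "t \<le> \<sigma> \<omega>"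
      using \<sigma>_alt[of \<omega>] that by (fastforce simp: S_def below_def not_le[symmetric])
  next
    assume "t \<le> \<sigma> \<omega>"
    then have "X i \<omega> \<le> xF - h i" if "i \<in> {1..<t}" for i
      using not_less_Least[of i "\<lambda>t. t = n + 1 \<or> t \<in> {1..n} \<and> xF - h t < X t \<omega>"]
        that \<open>t \<in> {1..n + 1}\<close>
      unfolding \<sigma>_def[symmetric] by auto
    then show "\<omega> \<in> S t" using that by (simp add: S_def below_def)
  qed
  have S_ev: "S t \<in> events" if "t \<in> {1..n + 1}" for t
    unfolding S_def using that by (intro below_events) auto
  have pol: "policy M n X \<sigma>"
    unfolding policy_def
  proof (intro conjI stopping_timeI ballI)
    fix t
    let ?F = "natural_filtration M (extend n X) t"
    show "Measurable.pred ?F (\<lambda>\<omega>. \<sigma> \<omega> \<le> t)"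
    proof (cases "t \<le> n")
      case True
      \<comment> \<open>Not having stopped by time \<open>t\<close> means \<open>S (t + 1)\<close>,
        an event about the first \<open>t\<close> observations only.\<close>
      have "{\<omega> \<in> space ?F. \<sigma> \<omega> \<le> t} = space ?F - S (t + 1)"
        using True S_iff[of _ "t + 1"] by auto
      also have "\<dots> \<in> sets ?F"
        unfolding S_def using True
        by (intro sets.compl_sets) (auto simp: sets_natural_filtration_extend intro!: below_observed)
      finally show ?thesis by (simp add: pred_def)
    next
      case False
      then have "\<sigma> \<omega> \<le> t" for \<omega> using \<sigma>_range[of \<omega>] by auto
      then show ?thesis by simp
    qed
    fix \<omega> show "\<sigma> \<omega> \<in> {1..n + 1}" by (rule \<sigma>_range)
  qed
  \<comment> \<open>A pointwise bound for the cost of \<open>\<sigma>\<close>: the difference of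
    indicators marks stopping exactly at \<open>t\<close>, and \<open>S (n + 1)\<close> marks never
    stopping.\<close>
  define H where
    "H \<omega> = (\<Sum>t\<in>{1..n}. h t * (indicator (S t) \<omega> - indicator (S (Suc t)) \<omega>)) + xF * indicator (S (n + 1)) \<omega>"
    for \<omega> :: 'a
  have "xF - H \<omega> \<le> extend n X (\<sigma> \<omega>) \<omega>" if \<omega>: "\<omega> \<in> space M" for \<omega>
  proof -
    have "(\<Sum>t\<in>{1..n}. h t * (indicator (S t) \<omega> - indicator (S (Suc t)) \<omega>))
        = (\<Sum>t\<in>{1..n}. if \<sigma> \<omega> = t then h t else 0)"
      using S_iff[OF \<omega>] by (intro sum.cong) (auto simp: indicator_def)
    also have "\<dots> = (if \<sigma> \<omega> \<in> {1..n} then h (\<sigma> \<omega>) else 0)" by simp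
    finally show ?thesis
      using \<sigma>_alt[of \<omega>] S_iff[OF \<omega>, of "n + 1"] by (auto simp: H_def extend_def indicator_def)
  qed
  moreover have int_H: "integrable M H"
    unfolding H_def[abs_def] using S_ev
    by (intro Bochner_Integration.integrable_add Bochner_Integration.integrable_sum
        integrable_mult_right Bochner_Integration.integrable_diff integrable_real_indicator) (auto simp: less_top[symmetric])
  ultimately have "(LINT \<omega>|M. xF - H \<omega>) \<le> expected_reward M n X \<sigma>"
    unfolding expected_reward_def using reward_integrable[OF pol] by (intro integral_mono) auto
  then have 1: "xF - (LINT \<omega>|M. H \<omega>) \<le> expected_reward M n X \<sigma>"
    using int_H by (simp add: prob_space)
  have Q_Suc: "Q (Suc t) = Q t * (1 - p t)" if "t \<in> {1..n}" for t
  proof -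
    have "Q k = (\<Prod>i\<in>{1..<k}. 1 - p i)" if "k \<in> {1..n + 1}" for k
      unfolding Q_def S_def p_def using that h by (intro prob_below) auto
    then show ?thesis using that by (simp add: atLeastLessThanSuc)
  qed
  have "(LINT \<omega>|M. H \<omega>) = (\<Sum>t\<in>{1..n}. h t * (Q t - Q (Suc t))) + xF * Q (n + 1)"
  proof -
    have ind: "integrable M (indicator (S t) :: 'a \<Rightarrow> real)" if "t \<in> {1..n + 1}" for t
      using S_ev[OF that] by (auto simp: less_top[symmetric])
    show ?thesis
      unfolding H_def Q_def using S_ev ind
      by (subst Bochner_Integration.integral_add)
         (auto simp: Bochner_Integration.integral_sum Bochner_Integration.integral_diff
           intro!: Bochner_Integration.integrable_sum integrable_mult_right Bochner_Integration.integrable_diff)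
  qed
  \<comment> \<open>Weighting the hypothesis on \<open>u\<close> by the probability
    \<open>Q t\<close> of reaching \<open>t\<close> makes the sum telescope; its last term cancels
    \<open>xF * Q (n + 1)\<close>.\<close>
  also have "(\<Sum>t\<in>{1..n}. h t * (Q t - Q (Suc t))) \<le> (\<Sum>t\<in>{1..n}. Q t * u t - Q (Suc t) * u (Suc t))"
  proof (rule sum_mono)
    fix t assume t: "t \<in> {1..n}"
    have "Q t * (p t * h t + (1 - p t) * u (t + 1)) \<le> Q t * u t"
      using step[OF t] by (intro mult_left_mono) (auto simp: p_def Q_def)
    then show "h t * (Q t - Q (Suc t)) \<le> Q t * u t - Q (Suc t) * u (Suc t)"
      by (simp add: Q_Suc[OF t] algebra_simps)
  qed
  also have "(\<Sum>t\<in>{1..n}. Q t * u t - Q (Suc t) * u (Suc t)) = Q 1 * u 1 - Q (n + 1) * u (n + 1)"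
    using sum_Suc_diff[of 1 n "\<lambda>t. - (Q t * u t)"] by simp
  also have "Q 1 = 1" by (simp add: Q_def S_def below_def prob_space)
  finally have "(LINT \<omega>|M. H \<omega>) \<le> u 1" using u by (simp add: mult.commute)
  with 1 pol that show thesis by fastforce
qed

end

subsection \<open>A recursion with power decay\<close>

text \<open>A discrete form of \<open>w' = - \<kappa> * w powr (1 + \<theta>)\<close>, along whose
  solutions \<open>w powr (-\<theta>)\<close> grows at the constant rate
  \<open>\<theta> * \<kappa>\<close>. The index counts the observations left.\<close>

primrec descent :: "real \<Rightarrow> real \<Rightarrow> real \<Rightarrow> nat \<Rightarrow> real" where
  "descent \<kappa> \<theta> v 0 = v"
| "descent \<kappa> \<theta> v (Suc k) = descent \<kappa> \<theta> v k * (1 - \<kappa> * descent \<kappa> \<theta> v k powr \<theta>)"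

text \<open>With \<open>x = \<kappa> * w powr \<theta>\<close>, one step multiplies
  \<open>w powr (-\<theta>)\<close> by
  \<open>(1 - x) powr (-\<theta>) \<ge> 1 + \<theta> * x\<close>, which adds at least
  \<open>\<theta> * \<kappa>\<close>. The last hypothesis keeps \<open>x < 1\<close>, so the values
  stay positive.\<close>

lemma descent_bounds:
  assumes "0 < v" "0 < \<theta>" "0 < \<kappa>" "\<kappa> * v powr \<theta> < 1"
  shows "0 < descent \<kappa> \<theta> v k \<and> descent \<kappa> \<theta> v k \<le> v \<and> \<theta> * \<kappa> * real k \<le> descent \<kappa> \<theta> v k powr (-\<theta>)"
proof (induction k)
  case 0
  show ?case using assms by simp
next
  case (Suc k)
  let ?w = "descent \<kappa> \<theta> v k"
  define x where "x = \<kappa> * ?w powr \<theta>"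
  have "?w powr \<theta> \<le> v powr \<theta>" using Suc assms by (intro powr_mono2) auto
  then have "x \<le> \<kappa> * v powr \<theta>" unfolding x_def using assms by (intro mult_left_mono) auto
  then have "x < 1" using assms(4) by linarith
  moreover have "0 < x" using assms Suc by (simp add: x_def)
  ultimately have x: "0 < x" "x < 1" by auto
  have "1 + \<theta> * x \<le> 1 + (-\<theta>) * ln (1 - x)"
    using mult_left_mono[of "ln (1 - x)" "- x" \<theta>] ln_le_minus_one[of "1 - x"] x assms by simp
  also have "\<dots> \<le> exp ((-\<theta>) * ln (1 - x))" by (rule exp_ge_add_one_self)
  also have "\<dots> = (1 - x) powr (-\<theta>)" using x by (simp add: powr_def)
  finally have "?w powr (-\<theta>) * (1 + \<theta> * x) \<le> ?w powr (-\<theta>) * (1 - x) powr (-\<theta>)"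
    by (intro mult_left_mono) auto
  also have "\<dots> = (?w * (1 - x)) powr (-\<theta>)" using x Suc by (simp add: powr_mult)
  also have "?w powr (-\<theta>) * (1 + \<theta> * x) = ?w powr (-\<theta>) + \<theta> * \<kappa>"
  proof -
    have "?w powr (-\<theta>) * ?w powr \<theta> = 1" using Suc by (simp add: powr_add[symmetric])
    then show ?thesis by (simp add: x_def algebra_simps)
  qed
  finally have "\<theta> * \<kappa> * real (Suc k) \<le> (?w * (1 - x)) powr (-\<theta>)" using Suc by (simp add: algebra_simps)
  moreover have "?w * (1 - x) \<le> ?w" using Suc x by (intro mult_left_le) auto
  then have "?w * (1 - x) \<le> v" using Suc by linarith
  ultimately show ?case using Suc x by (simp add: x_def)
qed

lemma descent_le_powr:
  assumes "0 < v" "0 < \<theta>" "0 < \<kappa>" "\<kappa> * v powr \<theta> < 1" "0 < k"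
  shows "descent \<kappa> \<theta> v k \<le> (\<theta> * \<kappa>) powr (-1/\<theta>) * real k powr (-1/\<theta>)"
proof -
  let ?w = "descent \<kappa> \<theta> v k"
  have w: "0 < ?w" "\<theta> * \<kappa> * real k \<le> ?w powr (-\<theta>)" using descent_bounds[OF assms(1-4)] by auto
  have "?w = (?w powr (-\<theta>)) powr (-1/\<theta>)" using w assms by (simp add: powr_powr)
  also have "\<dots> \<le> (\<theta> * \<kappa> * real k) powr (-1/\<theta>)"
    using w assms by (intro powr_mono2') auto
  finally show ?thesis using assms by (simp add: powr_mult)
qed

text \<open>Supplies the smallness hypothesis of \<open>descent_bounds\<close>:
  \<open>(\<epsilon> * v / D) powr \<theta>\<close> is at most 1, and the factor \<open>1/2\<close>
  makes the bound strict.\<close>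

lemma descent_rate:
  fixes \<epsilon> D v \<theta> :: real
  assumes "0 < \<epsilon>" "0 < D" "0 < v" "0 < \<theta>" "\<epsilon> * v \<le> D"
  shows "(\<epsilon> / D) powr \<theta> / 2 * v powr \<theta> < 1"
proof -
  have "(\<epsilon> / D) powr \<theta> * v powr \<theta> = (\<epsilon> * v / D) powr \<theta>"
    using assms by (simp add: powr_mult[symmetric])
  also have "\<dots> \<le> 1 powr \<theta>" using assms by (intro powr_mono2) auto
  finally show ?thesis by simp
qed

text \<open>A policy that with \<open>k\<close> observations left stops at a cost below \<open>\<epsilon> * descent _ _ _ (k - 1)\<close> has
  expected remaining cost at most \<open>descent _ _ _ k\<close>; \<open>\<epsilon> * xF \<le> xF - x0\<close> keeps
  the thresholds inside the support, and \<open>\<epsilon> \<le> 1/2\<close> makes stopping save at least half of that bound.\<close>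

lemma (in power_sample) descent_policy:
  fixes \<epsilon> \<kappa> :: real
  assumes \<epsilon>: "0 < \<epsilon>" "\<epsilon> \<le> 1/2" "\<epsilon> * xF \<le> xF - x0"
  defines "\<kappa> \<equiv> (\<epsilon> / (xF - x0)) powr \<theta> / 2"
  obtains \<sigma> where "policy M n X \<sigma>" "xF - descent \<kappa> \<theta> xF n \<le> expected_reward M n X \<sigma>"
proof -
  let ?v = "descent \<kappa> \<theta> xF"
  have pos: "0 < xF" "0 < xF - x0" using x0_nonneg x0_less by auto
  have \<kappa>_pos: "0 < \<kappa>" using \<epsilon> pos by (simp add: \<kappa>_def)
  \<comment> \<open>The left side is the probability of a cost below the threshold
    \<open>\<epsilon> * w\<close>, for thresholds inside the support.\<close>
  have \<kappa>: "(\<epsilon> * w / (xF - x0)) powr \<theta> = 2 * \<kappa> * w powr \<theta>" if "0 \<le> w" for w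
    using that \<epsilon> pos powr_mult[of "\<epsilon> / (xF - x0)" w \<theta>] by (simp add: \<kappa>_def)
  have small: "\<kappa> * xF powr \<theta> < 1"
    unfolding \<kappa>_def using \<epsilon> pos theta_pos by (intro descent_rate) auto
  note v = descent_bounds[OF pos(1) theta_pos \<kappa>_pos small]
  \<comment> \<open>At time \<open>t\<close> there are \<open>n + 1 - t\<close> observations left
    including the current one, and \<open>n - t\<close> after it; the threshold refers to the
    latter.\<close>
  show thesis
  proof (rule threshold_policy[of "\<lambda>t. \<epsilon> * ?v (n - t)" "\<lambda>t. ?v (n + 1 - t)"])
    fix t assume t: "t \<in> {1..n}"
    let ?w = "?v (n - t)"
    have "\<epsilon> * ?w \<le> \<epsilon> * xF" using v \<epsilon> by (intro mult_left_mono) auto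
    then show "0 \<le> \<epsilon> * ?w \<and> \<epsilon> * ?w \<le> xF - x0"
      using \<epsilon> mult_pos_pos[of \<epsilon> ?w] v[of "n - t"] by linarith
    let ?p = "2 * \<kappa> * ?w powr \<theta>"
    \<comment> \<open>Stopping saves at least half of \<open>?w\<close> with probability
      \<open>?p\<close>, so the expected cost is at most \<open>?w * (1 - ?p / 2)\<close>, which is
      one step of \<open>descent\<close>.\<close>
    have "?p * (\<epsilon> * ?w) \<le> ?p * (1 / 2 * ?w)"
      using \<epsilon> \<kappa>_pos v[of "n - t"] by (intro mult_left_mono mult_right_mono) auto
    moreover have "?v (n + 1 - t) = ?w * (1 - \<kappa> * ?w powr \<theta>)"
      using t by (simp add: Suc_diff_le)
    ultimately show "(\<epsilon> * ?w / (xF - x0)) powr \<theta> * (\<epsilon> * ?w) +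
        (1 - (\<epsilon> * ?w / (xF - x0)) powr \<theta>) * ?v (n + 1 - (t + 1)) \<le> ?v (n + 1 - t)"
      using v[of "n - t"] by (simp add: \<kappa> algebra_simps)
  qed (use that in auto)
qed

section \<open>Both bounds for the competitive ratio\<close>

theorem proposition17:
  fixes x0 xF \<theta> :: real
  assumes "0 \<le> x0" and "x0 < xF" and "0 < \<theta>"
  shows "\<exists>c C :: real. 0 < c \<and> 0 < C \<and>
    (\<forall>\<^sub>F n in sequentially.
      \<forall>(M :: 'a measure) X \<tau>.
        iid_sample M n X (F_cdf x0 xF \<theta>) \<longrightarrow> optimal_policy M n X \<tau> \<longrightarrow>
        c * real n powr (- 1 / \<theta>) \<le> 1 - CR M n X \<tau> \<and>
        1 - CR M n X \<tau> \<le> C * real n powr (- 1 / \<theta>))"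
proof -
  define d where "d = level_gap \<theta>"
  define \<epsilon> where "\<epsilon> = min (1/2) ((xF - x0) / xF)"
  define \<kappa> where "\<kappa> = (\<epsilon> / (xF - x0)) powr \<theta> / 2"
  define A where "A = (\<theta> * \<kappa>) powr (-1/\<theta>)"
  \<comment> \<open>Dividing by \<open>xF\<close> is safe for the lower bound because
    \<open>OPT\<close> is at most \<open>xF\<close>.\<close>
  define c where "c = (xF - x0) * d / 406 / xF"
  have pos: "0 < xF" "0 < xF - x0" using assms by auto
  have \<epsilon>: "0 < \<epsilon>" "\<epsilon> \<le> 1/2" "\<epsilon> * xF \<le> xF - x0"
    using pos by (auto simp: \<epsilon>_def min_def field_simps)
  have \<kappa>_pos: "0 < \<kappa>" using \<epsilon> pos by (simp add: \<kappa>_def)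
  have small: "\<kappa> * xF powr \<theta> < 1"
    unfolding \<kappa>_def using \<epsilon> pos assms by (intro descent_rate) auto
  have A_pos: "0 < A" using \<kappa>_pos assms by (simp add: A_def)
  have d_pos: "0 < d" using level_gap_pos assms by (simp add: d_def)
  have "(\<lambda>n. A * real n powr (-1/\<theta>)) \<longlonglongrightarrow> A * 0"
    using assms by (intro tendsto_mult_left tendsto_neg_powr filterlim_real_sequentially) auto
  then have "\<forall>\<^sub>F n in sequentially. A * real n powr (-1/\<theta>) < xF / 2"
    using pos by (intro order_tendstoD) auto
  then have "\<forall>\<^sub>F n in sequentially. \<forall>(M :: 'a measure) X \<tau>.
        iid_sample M n X (F_cdf x0 xF \<theta>) \<longrightarrow> optimal_policy M n X \<tau> \<longrightarrow>
        c * real n powr (- 1 / \<theta>) \<le> 1 - CR M n X \<tau> \<and>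
        1 - CR M n X \<tau> \<le> 2 * A / xF * real n powr (- 1 / \<theta>)"
    using eventually_ge_at_top[of 2]
  proof eventually_elim
    case (elim n)
    show ?case
    proof (intro allI impI)
      fix M :: "'a measure" and X \<tau>
      assume iid: "iid_sample M n X (F_cdf x0 xF \<theta>)" and opt: "optimal_policy M n X \<tau>"
      interpret prob_space M using iid by (simp add: iid_sample_def)
      interpret power_sample M n X x0 xF \<theta>
        by unfold_locales (use iid assms elim in auto)
      have \<tau>: "policy M n X \<tau>" using opt by (simp add: optimal_policy_def)
      let ?R = "expected_reward M n X \<tau>" and ?O = "OPT M n X" and ?b = "real n powr (-1/\<theta>)"
      obtain \<sigma> where \<sigma>: "policy M n X \<sigma>" "xF - descent \<kappa> \<theta> xF n \<le> expected_reward M n X \<sigma>"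
        using descent_policy[OF \<epsilon>] unfolding \<kappa>_def by blast
      have "descent \<kappa> \<theta> xF n \<le> A * ?b"
        unfolding A_def using pos assms \<kappa>_pos small elim by (intro descent_le_powr) auto
      moreover have "expected_reward M n X \<sigma> \<le> ?R"
        using opt \<sigma> by (auto simp: optimal_policy_def)
      ultimately have R: "xF - A * ?b \<le> ?R" using \<sigma> by simp
      have O: "?R \<le> ?O" "?O \<le> xF" using reward_le_OPT[OF \<tau>] OPT_le[OF \<tau>] by auto
      \<comment> \<open>For large \<open>n\<close> the loss bound \<open>A * ?b\<close> is below
        \<open>xF / 2\<close>, so \<open>OPT\<close> exceeds \<open>xF / 2\<close>; this gives the
        factor 2 in the upper constant.\<close>
      have O_half: "xF / 2 < ?O" using R O elim by simp
      then have O_pos: "0 < ?O" using pos by simp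
      have CR: "1 - CR M n X \<tau> = (?O - ?R) / ?O" using O_pos by (simp add: CR_def field_simps)
      have "c * ?b = (xF - x0) * d / 406 * ?b / xF" by (simp add: c_def)
      also have "\<dots> \<le> (?O - ?R) / xF"
        unfolding d_def using regret_ge_powr[OF elim(2) \<tau>] pos by (intro divide_right_mono) auto
      also have "\<dots> \<le> (?O - ?R) / ?O" using O O_pos pos by (intro divide_left_mono) auto
      finally have lower: "c * ?b \<le> (?O - ?R) / ?O" .
      have "(?O - ?R) / ?O \<le> (A * ?b) / (xF / 2)"
        using R O O_half pos by (intro frac_le) auto
      then show "c * ?b \<le> 1 - CR M n X \<tau> \<and> 1 - CR M n X \<tau> \<le> 2 * A / xF * ?b"
        using lower CR by (simp add: mult_ac)
    qed
  qed
  moreover have "0 < c" "0 < 2 * A / xF" using pos d_pos A_pos by (auto simp: c_def)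
  ultimately show ?thesis by blast
qed

end
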